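(* Let $\mathcal F_1$ and $\mathcal F_2$ be two saturated FDFAs recognizing the same language. Then $|\mathcal F_1|_{\leadsto}^{+}=|\mathcal F_2|_{\leadsto}^{+}$ and $|\mathcal F_1|_{\leadsto}^{-}=|\mathcal F_2|_{\leadsto}^{-}$.
   Context: $\Sigma$ is a finite alphabet. For a (complete deterministic) automaton $\mathcal A$ and $w\in\Sigma^*$, $\mathcal A(w)$ is the state reached from the initial state on reading $w$; $[\![\mathcal D]\!]$ is the language of a DFA $\mathcal D$. An FDFA is a pair $\mathcal F=(\mathcal Q,\{\mathcal P_q\}_{q\in Q})$ of a leading automaton structure $\mathcal Q$ (a complete deterministic automaton without acceptance, with state set $Q$) and a complete progress DFA $\mathcal P_q$ for each $q\in Q$; write $\mathcal P_u=\mathcal P_{\mathcal Q(u)}$ for $u\in\Sigma^*$. For $u\in\Sigma^*,v\in\Sigma^+$: $(u,v)$ is a decomposition of $w$ if $uv^\omega=w$; normalized if $\mathcal Q(uv)=\mathcal Q(u)$; duo-normalized if normalized and $\mathcal P_u(vv)=\mathcal P_u(v)$. An FDFA uses exact, normalized or duo-normalized acceptance: with exact acceptance, $(u,v)\in[\![\mathcal F]\!]$ iff $v\in[\![\mathcal P_u]\!]$; with normalized (resp. duo-normalized) acceptance, $(u,v)\in[\![\mathcal F]\!]$ iff there is a normalized (resp. duo-normalized) decomposition $(x,y)$ of $uv^\omega$ with $y\in[\![\mathcal P_x]\!]$. $\mathcal F$ is saturated if, for every ultimately periodic word $w$, all decompositions $(x,y)$ of $w$ of the type used agree on whether $y\in[\![\mathcal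 P_x]\!]$. $\mathcal F_1,\mathcal F_2$ recognize the same language if $[\![\mathcal F_1]\!]=[\![\mathcal F_2]\!]$. $(u,v)$ is persistent (wrt $\mathcal F$) if it is duo-normalized and for every $z\in\Sigma^*$ there is $i\ge 2$ with $\mathcal P_u(zv)=\mathcal P_u(zv^i)$. With $\prec$ the strict prefix relation, $v_1\prec v_2\prec\dots\prec v_k$ is a persistent chain of length $k$ wrt $u$ in $\mathcal F$ if $(u,v_i)$ is persistent for all $1\le i\le k$ and $(u,v_{i+1})\in[\![\mathcal F]\!]$ iff $(u,v_i)\notin[\![\mathcal F]\!]$ for all $1\le i<k$; it is positive if $(u,v_1)\in[\![\mathcal F]\!]$ and negative otherwise. The positive diameter measure $|\mathcal F|_{\leadsto}^{+}$ (resp. negative diameter measure $|\mathcal F|_{\leadsto}^{-}$) is the maximal $k$ such that there are $u\in\Sigma^*$ and a positive (resp. negative) persistent chain of length $k$ wrt $u$ in $\mathcal F$ ($0$ if there is none). *)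

theory Defs
  imports Main "HOL-Library.Extended_Nat" "HOL-Library.Sublist" "HOL-Library.Omega_Words_Fun"
begin

text \<open>
  Infinite words are functions on the natural numbers, with \<open>\<frown>\<close> for prepending a finite word and
  \<open>v\<^sup>\<omega>\<close> for infinite iteration. The latter is unspecified for \<open>v = []\<close>, so every definition below
  that uses it requires \<open>v \<noteq> []\<close>.
\<close>

record ('q, 'a) automaton =
  states :: "'q set"
  initial :: 'q
  trans :: "'q \<Rightarrow> 'a \<Rightarrow> 'q"

record ('q, 'a) dfa = "('q, 'a) automaton" +
  accepting :: "'q set"

definition automaton :: "('q, 'a::finite, 'm) automaton_scheme \<Rightarrow> bool" where
  "automaton A \<longleftrightarrow> finite (states A) \<and> initial A \<in> states A \<and>
     (\<forall>q\<in>states A. \<forall>a. trans A q a \<in> states A)"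

definition dfa :: "('q, 'a::finite) dfa \<Rightarrow> bool" where
  "dfa D \<longleftrightarrow> automaton D \<and> accepting D \<subseteq> states D"

definition run :: "('q, 'a, 'm) automaton_scheme \<Rightarrow> 'a list \<Rightarrow> 'q" where
  "run A w = foldl (trans A) (initial A) w"

definition dfa_language :: "('q, 'a) dfa \<Rightarrow> 'a list set" where
  "dfa_language D = {w. run D w \<in> accepting D}"

text \<open>
  The progress DFAs of one FDFA share a state type but each has its own set of states.
  Values of \<open>progress\<close> outside the states of the leading automaton are irrelevant.
\<close>

record ('q, 's, 'a) fdfa =
  leading :: "('q, 'a) automaton"
  progress :: "'q \<Rightarrow> ('s, 'a) dfa"

definition fdfa :: "('q, 's, 'a::finite) fdfa \<Rightarrow> bool" where
  "fdfa F \<longleftrightarrow> automaton (leading F) \<and> (\<forall>q\<in>states (leading F). dfa (progress F q))"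

definition progress_at :: "('q, 's, 'a) fdfa \<Rightarrow> 'a list \<Rightarrow> ('s, 'a) dfa" where
  "progress_at F u = progress F (run (leading F) u)"

definition decomposition :: "'a list \<Rightarrow> 'a list \<Rightarrow> 'a word \<Rightarrow> bool" where
  "decomposition u v w \<longleftrightarrow> v \<noteq> [] \<and> u \<frown> v\<^sup>\<omega> = w"

definition ultimately_periodic :: "'a word \<Rightarrow> bool" where
  "ultimately_periodic w \<longleftrightarrow> (\<exists>u v. decomposition u v w)"

definition normalized :: "('q, 's, 'a) fdfa \<Rightarrow> 'a list \<Rightarrow> 'a list \<Rightarrow> bool" where
  "normalized F u v \<longleftrightarrow> v \<noteq> [] \<and> run (leading F) (u @ v) = run (leading F) u"

definition duo_normalized :: "('q, 's, 'a) fdfa \<Rightarrow> 'a list \<Rightarrow> 'a list \<Rightarrow> bool" where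
  "duo_normalized F u v \<longleftrightarrow>
     normalized F u v \<and> run (progress_at F u) (v @ v) = run (progress_at F u) v"

datatype acceptance = Exact | Normalized | Duo_Normalized

primrec admissible :: "acceptance \<Rightarrow> ('q, 's, 'a) fdfa \<Rightarrow> 'a list \<Rightarrow> 'a list \<Rightarrow> bool" where
  "admissible Exact F u v \<longleftrightarrow> v \<noteq> []"
| "admissible Normalized F u v \<longleftrightarrow> normalized F u v"
| "admissible Duo_Normalized F u v \<longleftrightarrow> duo_normalized F u v"

primrec language :: "acceptance \<Rightarrow> ('q, 's, 'a) fdfa \<Rightarrow> ('a list \<times> 'a list) set" where
  "language Exact F = {(u, v). v \<noteq> [] \<and> v \<in> dfa_language (progress_at F u)}"
| "language Normalized F = {(u, v). v \<noteq> [] \<and>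
     (\<exists>x y. decomposition x y (u \<frown> v\<^sup>\<omega>) \<and> normalized F x y \<and>
        y \<in> dfa_language (progress_at F x))}"
| "language Duo_Normalized F = {(u, v). v \<noteq> [] \<and>
     (\<exists>x y. decomposition x y (u \<frown> v\<^sup>\<omega>) \<and> duo_normalized F x y \<and>
        y \<in> dfa_language (progress_at F x))}"

definition saturated :: "acceptance \<Rightarrow> ('q, 's, 'a) fdfa \<Rightarrow> bool" where
  "saturated t F \<longleftrightarrow>
     (\<forall>w. ultimately_periodic w \<longrightarrow>
        (\<forall>x y x' y'. decomposition x y w \<and> admissible t F x y \<and>
           decomposition x' y' w \<and> admissible t F x' y' \<longrightarrow>
           (y \<in> dfa_language (progress_at F x) \<longleftrightarrow> y' \<in> dfa_language (progress_at F x'))))"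

definition persistent :: "('q, 's, 'a) fdfa \<Rightarrow> 'a list \<Rightarrow> 'a list \<Rightarrow> bool" where
  "persistent F u v \<longleftrightarrow> duo_normalized F u v \<and>
     (\<forall>z. \<exists>i\<ge>2. run (progress_at F u) (z @ v) =
                 run (progress_at F u) (z @ concat (replicate i v)))"

definition persistent_chain ::
  "acceptance \<Rightarrow> ('q, 's, 'a) fdfa \<Rightarrow> 'a list \<Rightarrow> 'a list list \<Rightarrow> bool" where
  "persistent_chain t F u vs \<longleftrightarrow> vs \<noteq> [] \<and>
     (\<forall>i < length vs. persistent F u (vs ! i)) \<and>
     (\<forall>i. Suc i < length vs \<longrightarrow> strict_prefix (vs ! i) (vs ! Suc i) \<and>
        ((u, vs ! Suc i) \<in> language t F \<longleftrightarrow> (u, vs ! i) \<notin> language t F))"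

definition positive_chain ::
  "acceptance \<Rightarrow> ('q, 's, 'a) fdfa \<Rightarrow> 'a list \<Rightarrow> 'a list list \<Rightarrow> bool" where
  "positive_chain t F u vs \<longleftrightarrow> persistent_chain t F u vs \<and> (u, hd vs) \<in> language t F"

definition negative_chain ::
  "acceptance \<Rightarrow> ('q, 's, 'a) fdfa \<Rightarrow> 'a list \<Rightarrow> 'a list list \<Rightarrow> bool" where
  "negative_chain t F u vs \<longleftrightarrow> persistent_chain t F u vs \<and> (u, hd vs) \<notin> language t F"

text \<open>
  As an extended natural number, the supremum of a set of chain lengths is its maximum when one
  exists, \<open>0\<close> for the empty set, and \<open>\<infinity>\<close> when the lengths are unbounded.
\<close>

definition positive_diameter :: "acceptance \<Rightarrow> ('q, 's, 'a) fdfa \<Rightarrow> enat" where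
  "positive_diameter t F = Sup {enat (length vs) | u vs. positive_chain t F u vs}"

definition negative_diameter :: "acceptance \<Rightarrow> ('q, 's, 'a) fdfa \<Rightarrow> enat" where
  "negative_diameter t F = Sup {enat (length vs) | u vs. negative_chain t F u vs}"

end

theory Submission
  imports Defs
begin

text \<open>
  A language of a saturated FDFA depends only on the \<open>\<omega>\<close>-word \<open>u \<frown> v\<^sup>\<omega>\<close>, so it suffices to turn a
  persistent chain \<open>v\<^sub>0 \<prec> v\<^sub>1 \<prec> \<dots>\<close> wrt \<open>u\<close> in one FDFA into an equally long chain of the other FDFA
  that yields \<open>\<omega>\<close>-words with the same membership. Write \<open>v\<^sub>i\<^sub>+\<^sub>1 = v\<^sub>i x\<^sub>i\<close> and let \<open>c\<close> be such that
  \<open>y\<^sup>c\<close> acts idempotently on both FDFAs for every word \<open>y\<close>. By persistence, \<open>y\<^sub>0 = v\<^sub>0\<close> and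
  \<open>y\<^sub>i\<^sub>+\<^sub>1 = y\<^sub>i\<^sup>2\<^sup>c\<^sup>+\<^sup>1 x\<^sub>i\<close> act like \<open>v\<^sub>i\<close> on the progress DFA at \<open>u\<close> of the first FDFA. The words
  \<open>y\<^sub>i\<^sup>c\<close> act idempotently on the second FDFA, but they need a state of its leading automaton that is
  fixed by all of them. This is obtained by rotation: \<open>r\<^sub>i = y\<^sub>i\<^sub>-\<^sub>1\<^sup>c \<dots> y\<^sub>0\<^sup>c\<close> is a prefix of \<open>y\<^sub>i\<close>, say
  \<open>y\<^sub>i = r\<^sub>i s\<^sub>i\<close>, and the words \<open>(s\<^sub>i r\<^sub>i)\<^sup>c\<close> form a chain all of whose members loop after \<open>u r\<^sub>k\<close>.
\<close>

section \<open>Powers and omega-powers of finite words\<close>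

abbreviation word_power :: "nat \<Rightarrow> 'a list \<Rightarrow> 'a list" where
  "word_power n v \<equiv> concat (replicate n v)"

lemma word_power_add: "word_power (m + n) v = word_power m v @ word_power n v"
  by (simp add: replicate_add)

lemma word_power_rotate: "r @ word_power n (s @ r) = word_power n (r @ s) @ r"
  by (induction n) auto

text \<open>Both words satisfy the same unrolling equation, so a position beyond \<open>v\<close>
  reduces to one that is smaller by \<open>length v > 0\<close>. Later identities between
  omega-powers only need to check this fixed-point equation.\<close>

lemma iter_unique:
  assumes "v \<noteq> []" and "w = v \<frown> w"
  shows "w = v\<^sup>\<omega>"
proof
  fix n
  show "w n = v\<^sup>\<omega> n"
  proof (induction n rule: less_induct)
    case (less n)
    have step: "w' n = (if n < length v then v ! n else w' (n - length v))"
      if "w' = v \<frown> w'" for w'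
      using fun_cong[OF that, of n] by (simp add: conc_def)
    have "v\<^sup>\<omega> = v \<frown> v\<^sup>\<omega>"
      using iter_unroll[of v] assms(1) by (metis length_greater_0_conv)
    moreover have "w (n - length v) = v\<^sup>\<omega> (n - length v)" if "\<not> n < length v"
      using assms(1) that by (intro less.IH) (cases v; simp)
    ultimately show ?case
      using step[of w] step[of "v\<^sup>\<omega>"] assms(2) by presburger
  qed
qed

lemma word_power_conc_iter: "v \<noteq> [] \<Longrightarrow> word_power n v \<frown> v\<^sup>\<omega> = v\<^sup>\<omega>"
proof (induction n)
  case (Suc n)
  have "word_power (Suc n) v \<frown> v\<^sup>\<omega> = v \<frown> (word_power n v \<frown> v\<^sup>\<omega>)"
    by simp
  also have "\<dots> = v\<^sup>\<omega>"
    using Suc iter_unroll[of v] by (metis length_greater_0_conv)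
  finally show ?case .
qed simp

lemma iter_word_power:
  assumes "v \<noteq> []" and "n > 0"
  shows "(word_power n v)\<^sup>\<omega> = v\<^sup>\<omega>"
  using iter_unique[of "word_power n v" "v\<^sup>\<omega>"] word_power_conc_iter[of v n] assms by auto

lemma conc_iter_rotate:
  assumes "r @ s \<noteq> []"
  shows "r \<frown> (s @ r)\<^sup>\<omega> = (r @ s)\<^sup>\<omega>"
proof (rule iter_unique[OF assms])
  have "(s @ r)\<^sup>\<omega> = (s @ r) \<frown> (s @ r)\<^sup>\<omega>"
    using assms by (intro iter_unroll) auto
  then show "r \<frown> (s @ r)\<^sup>\<omega> = (r @ s) \<frown> (r \<frown> (s @ r)\<^sup>\<omega>)"
    by (metis append.assoc conc_conc)
qed

section \<open>Idempotent powers in finite automata\<close>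

text \<open>By pigeonhole the orbit of \<open>q\<close> becomes periodic after some
  \<open>i < n\<close> steps, with a period \<open>d <= n\<close>. The exponent
  \<open>fact n\<close> exceeds every such \<open>i\<close> and is a multiple of every such
  \<open>d\<close>, so it serves all functions and points at once.\<close>

lemma funpow_fact_idempotent:
  assumes "finite S" and "\<And>p. p \<in> S \<Longrightarrow> f p \<in> S" and "q \<in> S" and "card S \<le> n"
  shows "(f ^^ fact n) ((f ^^ fact n) q) = (f ^^ fact n) q"
proof -
  have in_S: "(f ^^ i) q \<in> S" for i
    using assms(2,3) by (induction i) auto
  have "\<not> inj_on (\<lambda>i. (f ^^ i) q) {..n}"
  proof
    assume "inj_on (\<lambda>i. (f ^^ i) q) {..n}"
    then have "card {..n} \<le> card S"
      using in_S assms(1) by (intro card_inj_on_le) auto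
    with assms(4) show False by simp
  qed
  then obtain i j where ij: "i < j" "j \<le> n" "(f ^^ i) q = (f ^^ j) q"
    unfolding inj_on_def by (metis atMost_iff linorder_neqE_nat)
  define d where "d = j - i"
  have period: "(f ^^ (m + d)) q = (f ^^ m) q" if "i \<le> m" for m
  proof -
    have "(f ^^ (m + d)) q = (f ^^ (m - i)) ((f ^^ j) q)"
      using that ij(1) by (simp add: d_def flip: funpow_add comp_apply[of "f ^^ _" "f ^^ _"])
    also have "\<dots> = (f ^^ m) q"
      using that by (simp add: ij(3)[symmetric] flip: funpow_add comp_apply[of "f ^^ _" "f ^^ _"])
    finally show ?thesis .
  qed
  have "d dvd fact n"
    using ij by (intro dvd_fact) (auto simp: d_def)
  then obtain t where t: "fact n = d * t" by blast
  have "(f ^^ (fact n + d * s)) q = (f ^^ fact n) q" for s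
  proof (induction s)
    case (Suc s)
    have "i \<le> fact n + d * s"
      using ij fact_ge_self[of n] by linarith
    from period[OF this] Suc show ?case
      by (simp add: algebra_simps)
  qed simp
  from this[of t] show ?thesis
    by (simp add: funpow_add flip: t)
qed

lemma run_append: "run D (u @ v) = foldl (trans D) (run D u) v"
  by (simp add: run_def)

lemma run_append_cong: "run D u = run D v \<Longrightarrow> run D (u @ w) = run D (v @ w)"
  by (simp add: run_append)

lemma run_in_states: "automaton D \<Longrightarrow> run D w \<in> states D"
  by (induction w rule: rev_induct) (auto simp: automaton_def run_def)

lemma foldl_in_states: "automaton D \<Longrightarrow> q \<in> states D \<Longrightarrow> foldl (trans D) q w \<in> states D"
  by (induction w arbitrary: q) (auto simp: automaton_def)

lemma foldl_word_power:
  "foldl f q (word_power n v) = ((\<lambda>q. foldl f q v) ^^ n) q"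
  by (induction n arbitrary: q) (simp_all add: funpow_Suc_right del: funpow.simps(2))

text \<open>Ranging over the prefixes \<open>z\<close> expresses that the \<open>c\<close>-th power
  of any word acts idempotently on all reachable states.\<close>

definition stabilizing :: "('q, 'a, 'm) automaton_scheme \<Rightarrow> nat \<Rightarrow> bool" where
  "stabilizing D c \<longleftrightarrow>
     (\<forall>z y. run D (z @ word_power c y @ word_power c y) = run D (z @ word_power c y))"

lemma stabilizing_fact:
  assumes "automaton D" and "card (states D) \<le> n"
  shows "stabilizing D (fact n)"
  unfolding stabilizing_def
proof (intro allI)
  fix z y
  from funpow_fact_idempotent[OF _ foldl_in_states[OF assms(1), of _ y] run_in_states[OF assms(1)] assms(2)]
    assms(1)
  show "run D (z @ word_power (fact n) y @ word_power (fact n) y) = run D (z @ word_power (fact n) y)"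
    by (simp add: run_append foldl_word_power automaton_def)
qed

lemma stabilizing_mult:
  assumes "stabilizing D c" and "n > 0"
  shows "run D (z @ word_power (n * c) y) = run D (z @ word_power c y)"
  using assms(2)
proof (induction n rule: nat_induct_non_zero)
  case (Suc n)
  have "run D (z @ word_power (Suc n * c) y) = run D (z @ word_power (n * c) y @ word_power c y)"
    by (simp add: add.commute[of c] word_power_add)
  also have "\<dots> = run D (z @ word_power c y @ word_power c y)"
    using run_append_cong[OF Suc.IH] by simp
  finally show ?case
    using assms(1) by (simp add: stabilizing_def)
qed simp

text \<open>There are finitely many progress DFAs, so one bound covers their sizes and that of the
  leading automaton. Allowing every \<open>n\<close> above it makes the bounds of two FDFAs combine
  by \<open>max\<close>.\<close>

lemma fdfa_stabilizing:
  assumes "fdfa F"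
  obtains m where "\<And>n. m \<le> n \<Longrightarrow> stabilizing (leading F) (fact n)"
    and "\<And>n u. m \<le> n \<Longrightarrow> stabilizing (progress_at F u) (fact n)"
proof -
  let ?Q = "states (leading F)"
  let ?cards = "insert (card ?Q) ((\<lambda>q. card (states (progress F q))) ` ?Q)"
  have leading: "automaton (leading F)" and "finite ?cards"
    using assms by (auto simp: fdfa_def automaton_def)
  then have le: "k \<le> Max ?cards" if "k \<in> ?cards" for k
    using that by (intro Max_ge)
  show thesis
  proof (rule that)
    fix n u
    assume n: "Max ?cards \<le> n"
    show "stabilizing (leading F) (fact n)"
      using le n leading by (intro stabilizing_fact) (auto intro: order_trans)
    have "run (leading F) u \<in> ?Q"
      using run_in_states[OF leading] .
    then show "stabilizing (progress_at F u) (fact n)"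
      unfolding progress_at_def using le n assms
      by (intro stabilizing_fact) (auto simp: fdfa_def dfa_def intro: order_trans[OF le])
  qed
qed

section \<open>Persistence, and membership under saturation\<close>

text \<open>Persistence gives, for each \<open>z\<close>, a period \<open>j = i - 1\<close> after
  \<open>z @ v\<close>, but \<open>j\<close> depends on \<open>z\<close>. Stabilization removes this
  dependence: for positive \<open>n\<close> the exponent \<open>n * c\<close> can be exchanged for
  \<open>j * c\<close>, a multiple of the period.\<close>

lemma persistent_absorbs_power:
  assumes "persistent F u v" and "stabilizing (progress_at F u) c"
  shows "run (progress_at F u) (z @ word_power (Suc (n * c)) v) = run (progress_at F u) (z @ v)"
proof (cases n)
  case (Suc k)
  let ?D = "progress_at F u"
  obtain i where i: "i \<ge> 2" "run ?D (z @ v) = run ?D (z @ word_power i v)"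
    using assms(1) unfolding persistent_def by blast
  define j where "j = i - 1"
  have j: "j > 0" "i = Suc j" using i(1) by (auto simp: j_def)
  have iterate: "run ?D (z @ v @ word_power (t * j) v) = run ?D (z @ v)" for t
  proof (induction t)
    case (Suc t)
    have "run ?D (z @ v @ word_power (Suc t * j) v) = run ?D (z @ v @ word_power j v @ word_power (t * j) v)"
      by (simp add: word_power_add)
    also have "\<dots> = run ?D (z @ v @ word_power (t * j) v)"
      using run_append_cong[OF i(2), of "word_power (t * j) v"] j(2) by simp
    finally show ?case using Suc by simp
  qed simp
  have "run ?D (z @ word_power (Suc (n * c)) v) = run ?D ((z @ v) @ word_power (n * c) v)"
    by simp
  also have "\<dots> = run ?D ((z @ v) @ word_power c v)"
    using Suc by (intro stabilizing_mult[OF assms(2)]) simp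
  also have "\<dots> = run ?D ((z @ v) @ word_power (j * c) v)"
    using j(1) by (intro stabilizing_mult[OF assms(2), symmetric])
  also have "\<dots> = run ?D (z @ v)"
    using iterate[of c] by (simp add: mult.commute)
  finally show ?thesis .
qed simp

text \<open>A duo-normalized decomposition is admissible for all three acceptance types, so
  saturation lets this single one decide membership.\<close>

lemma language_iff_duo_normalized:
  assumes "saturated t F" and "v \<noteq> []" and "u \<frown> v\<^sup>\<omega> = x \<frown> y\<^sup>\<omega>" and "duo_normalized F x y"
  shows "(u, v) \<in> language t F \<longleftrightarrow> y \<in> dfa_language (progress_at F x)"
proof -
  have y: "normalized F x y" "y \<noteq> []"
    using assms(4) by (auto simp: duo_normalized_def normalized_def)
  have dec: "decomposition u v (x \<frown> y\<^sup>\<omega>)" "decomposition x y (x \<frown> y\<^sup>\<omega>)"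
    using assms(2,3) y by (auto simp: decomposition_def)
  have "admissible t F x y"
    using assms(4) y by (cases t) auto
  moreover have "ultimately_periodic (x \<frown> y\<^sup>\<omega>)"
    using dec(2) unfolding ultimately_periodic_def by (intro exI)
  ultimately have agree: "z' \<in> dfa_language (progress_at F z) \<longleftrightarrow> y \<in> dfa_language (progress_at F x)"
    if "decomposition z z' (x \<frown> y\<^sup>\<omega>)" "admissible t F z z'" for z z'
    using assms(1)[unfolded saturated_def, rule_format, of "x \<frown> y\<^sup>\<omega>" z z' x y] dec(2) that by simp
  show ?thesis
  proof (cases t)
    case Exact
    then show ?thesis using agree[OF dec(1)] assms(2) by simp
  next
    case Normalized
    have "(u, v) \<in> language t F \<longleftrightarrow> (\<exists>z z'. decomposition z z' (x \<frown> y\<^sup>\<omega>) \<and>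
        normalized F z z' \<and> z' \<in> dfa_language (progress_at F z))"
      using assms(2) by (simp add: Normalized assms(3) del: conc_conc)
    with agree dec(2) y(1) show ?thesis
      unfolding Normalized admissible.simps by metis
  next
    case Duo_Normalized
    have "(u, v) \<in> language t F \<longleftrightarrow> (\<exists>z z'. decomposition z z' (x \<frown> y\<^sup>\<omega>) \<and>
        duo_normalized F z z' \<and> z' \<in> dfa_language (progress_at F z))"
      using assms(2) by (simp add: Duo_Normalized assms(3) del: conc_conc)
    with agree dec(2) assms(4) show ?thesis
      unfolding Duo_Normalized admissible.simps by metis
  qed
qed

section \<open>The pumped words and their rotations\<close>

context
  fixes c :: nat and v :: "nat \<Rightarrow> 'a list"
begin

definition suffix_step :: "nat \<Rightarrow> 'a list" where
  "suffix_step i = drop (length (v i)) (v (Suc i))"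

text \<open>In the exponent \<open>2 * c + 1\<close>, the first \<open>c\<close> copies extend
  \<open>descent i\<close>, the middle copy splits into \<open>descent i\<close> and
  \<open>rest i\<close>, and the last \<open>c\<close> copies make \<open>rest (Suc i)\<close> begin
  with \<open>rotated i\<close>.\<close>

primrec pumped :: "nat \<Rightarrow> 'a list" where
  "pumped 0 = v 0"
| "pumped (Suc i) = word_power (Suc (2 * c)) (pumped i) @ suffix_step i"

primrec descent :: "nat \<Rightarrow> 'a list" where
  "descent 0 = []"
| "descent (Suc i) = word_power c (pumped i) @ descent i"

primrec rest :: "nat \<Rightarrow> 'a list" where
  "rest 0 = v 0"
| "rest (Suc i) = rest i @ word_power c (pumped i) @ suffix_step i"

definition rotated :: "nat \<Rightarrow> 'a list" where
  "rotated i = word_power c (rest i @ descent i)"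

lemma descent_rest: "descent i @ rest i = pumped i"
proof (induction i)
  case (Suc i)
  have "pumped i @ word_power c (pumped i) = word_power c (pumped i) @ pumped i"
    using word_power_rotate[of "pumped i" c "[]"] by simp
  with Suc show ?case
    by (simp add: mult_2 word_power_add)
qed simp

lemma rest_descent_nonempty: "v 0 \<noteq> [] \<Longrightarrow> rest i \<noteq> []"
  by (induction i) auto

text \<open>Rotating the last block of powers past \<open>rest i\<close> exposes
  \<open>rotated i\<close> at the front of \<open>rest (Suc i)\<close>, hence of every positive
  power of a word that begins with \<open>rest (Suc i)\<close>.\<close>

lemma strict_prefix_rotated:
  assumes "c > 0" and "suffix_step i \<noteq> []"
  shows "strict_prefix (rotated i) (rotated (Suc i))"
proof -
  have "rest i @ word_power c (pumped i) = rotated i @ rest i"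
    unfolding rotated_def descent_rest[symmetric] by (rule word_power_rotate)
  then have "rest (Suc i) = rotated i @ rest i @ suffix_step i"
    by (metis append.assoc rest.simps(2))
  moreover obtain d where "c = Suc d" using assms(1) gr0_conv_Suc by blast
  ultimately have "\<exists>z. rotated (Suc i) = rotated i @ (rest i @ suffix_step i) @ z"
    unfolding rotated_def[of "Suc i"] by (simp del: rest.simps)
  then show ?thesis
    using assms(2) by (auto simp: strict_prefix_def)
qed

lemma descent_rotated: "descent i @ rotated i = word_power c (pumped i) @ descent i"
  unfolding rotated_def descent_rest[symmetric] by (rule word_power_rotate)

lemma descent_conc_rotated_iter:
  assumes "c > 0" and "v 0 \<noteq> []"
  shows "descent i \<frown> (rotated i)\<^sup>\<omega> = (pumped i)\<^sup>\<omega>"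
  unfolding rotated_def descent_rest[symmetric]
  using assms rest_descent_nonempty[of i]
  by (simp add: iter_word_power conc_iter_rotate)

text \<open>Here \<open>h\<close> collects the powers of \<open>pumped j\<close> for
  \<open>i < j < k\<close>. Each of them loops at the state reached by \<open>u\<close>, hence so
  does \<open>h\<close>.\<close>

lemma descent_decomp:
  assumes "i < k" and "\<And>j. j < k \<Longrightarrow> run D (u @ pumped j) = run D u"
  obtains h where "descent k = h @ word_power c (pumped i) @ descent i"
    and "run D (u @ h) = run D u"
proof -
  have power: "run D (u @ word_power n (pumped j)) = run D u" if "j < k" for n j
  proof (induction n)
    case (Suc n)
    then show ?case
      using run_append_cong[OF assms(2)[OF that], of "word_power n (pumped j)"] by simp
  qed simp
  have "\<exists>h. descent m = h @ word_power c (pumped i) @ descent i \<and> run D (u @ h) = run D u"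
    if "Suc i \<le> m" "m \<le> k" for m
    using that
  proof (induction m rule: dec_induct)
    case base
    then show ?case by (intro exI[of _ "[]"]) simp
  next
    case (step m)
    then obtain h where h: "descent m = h @ word_power c (pumped i) @ descent i"
      "run D (u @ h) = run D u" by auto
    have "run D (u @ word_power c (pumped m) @ h) = run D u"
      using run_append_cong[OF power[of m c], of h] h(2) step.prems by simp
    with h(1) show ?case
      by (intro exI[of _ "word_power c (pumped m) @ h"]) simp
  qed
  from this[of k] assms(1) that show thesis by auto
qed

text \<open>Both claims are proved in one induction. The progress claim ranges over all
  \<open>z\<close> because words are replaced inside powers, after arbitrary prefixes; the leading
  claim concerns only the state of \<open>u\<close>, where the \<open>v j\<close> loop.\<close>

lemma run_pumped:
  assumes "i < k"
    and "\<And>j. j < k \<Longrightarrow> persistent F u (v j)"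
    and "\<And>j. Suc j < k \<Longrightarrow> v (Suc j) = v j @ suffix_step j"
    and "stabilizing (progress_at F u) c"
  shows "run (progress_at F u) (z @ pumped i) = run (progress_at F u) (z @ v i)"
    and "run (leading F) (u @ pumped i) = run (leading F) u"
proof -
  let ?D = "progress_at F u"
  let ?Q = "leading F"
  have "(\<forall>z. run ?D (z @ pumped i) = run ?D (z @ v i)) \<and> run ?Q (u @ pumped i) = run ?Q u"
    using assms(1)
  proof (induction i)
    case 0
    with assms(2)[of 0] show ?case
      by (simp add: persistent_def duo_normalized_def normalized_def)
  next
    case (Suc i)
    then have IH: "\<And>z. run ?D (z @ pumped i) = run ?D (z @ v i)" "run ?Q (u @ pumped i) = run ?Q u"
      by auto
    have D: "run ?D (z @ word_power n (pumped i)) = run ?D (z @ word_power n (v i))" for z n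
    proof (induction n arbitrary: z)
      case (Suc n)
      show ?case
        using Suc[of "z @ pumped i"] run_append_cong[OF IH(1)[of z]] by simp
    qed simp
    have Q: "run ?Q (u @ word_power n (pumped i)) = run ?Q u" for n
    proof (induction n)
      case (Suc n)
      then show ?case
        using run_append_cong[OF IH(2), of "word_power n (pumped i)"] by simp
    qed simp
    have loop: "run ?Q (u @ v j) = run ?Q u" if "j < k" for j
      using assms(2)[OF that] by (simp add: persistent_def duo_normalized_def normalized_def)
    have v: "v (Suc i) = v i @ suffix_step i"
      using assms(3) Suc.prems by simp
    have "run ?D (z @ pumped (Suc i)) = run ?D (z @ v (Suc i))" for z
    proof -
      \<comment> \<open>The power of \<open>pumped i\<close> acts like that of \<open>v i\<close>,
        which persistence collapses to \<open>v i\<close>.\<close>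
      have "run ?D (z @ word_power (Suc (2 * c)) (pumped i)) = run ?D (z @ v i)"
        using D persistent_absorbs_power[OF assms(2,4), of i z 2] Suc.prems
        by (metis Suc_lessD)
      from run_append_cong[OF this, of "suffix_step i"] v show ?thesis by simp
    qed
    moreover have "run ?Q (u @ pumped (Suc i)) = run ?Q u"
    proof -
      \<comment> \<open>Since \<open>v i\<close> loops at \<open>u\<close>, the extension alone acts
        there like \<open>v (Suc i)\<close>, which loops too.\<close>
      have "run ?Q (u @ pumped (Suc i)) = run ?Q (u @ suffix_step i)"
        using run_append_cong[OF Q[of "Suc (2 * c)"], of "suffix_step i"] by simp
      also have "\<dots> = run ?Q (u @ v (Suc i))"
        using run_append_cong[OF loop[of i], of "suffix_step i"] v Suc.prems by simp
      finally show ?thesis using loop Suc.prems by simp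
    qed
    ultimately show ?case by blast
  qed
  then show "run ?D (z @ pumped i) = run ?D (z @ v i)" "run ?Q (u @ pumped i) = run ?Q u"
    by auto
qed

end

section \<open>Transfer of chains and comparison of diameters\<close>

lemma persistent_chain_transfer:
  fixes F1 :: "('q1, 's1, 'a::finite) fdfa" and F2 :: "('q2, 's2, 'a) fdfa"
  assumes "fdfa F1" and "fdfa F2" and "saturated t1 F1"
    and lang: "language t1 F1 = language t2 F2"
    and chain: "persistent_chain t1 F1 u vs"
  obtains u' ws where "length ws = length vs" and "persistent_chain t2 F2 u' ws"
    and "(u', hd ws) \<in> language t2 F2 \<longleftrightarrow> (u, hd vs) \<in> language t1 F1"
proof -
  obtain m1 where m1: "\<And>n. m1 \<le> n \<Longrightarrow> stabilizing (leading F1) (fact n)"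
    "\<And>n u. m1 \<le> n \<Longrightarrow> stabilizing (progress_at F1 u) (fact n)"
    using fdfa_stabilizing[OF assms(1)] by blast
  obtain m2 where m2: "\<And>n. m2 \<le> n \<Longrightarrow> stabilizing (leading F2) (fact n)"
    "\<And>n u. m2 \<le> n \<Longrightarrow> stabilizing (progress_at F2 u) (fact n)"
    using fdfa_stabilizing[OF assms(2)] by blast
  \<comment> \<open>A factorial above both bounds stabilizes all automata of both FDFAs.\<close>
  define c :: nat where "c = fact (max m1 m2)"
  have c: "c > 0" "\<And>u. stabilizing (progress_at F1 u) c" "stabilizing (leading F2) c"
    "\<And>u. stabilizing (progress_at F2 u) c"
    using m1 m2 by (auto simp: c_def)
  define v where "v = (!) vs"
  define k where "k = length vs"
  define y where "y = pumped c v"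
  define w where "w = rotated c v"
  define u' where "u' = u @ descent c v k"
  have k: "k > 0" and pers: "\<And>i. i < k \<Longrightarrow> persistent F1 u (v i)"
    and pref: "\<And>i. Suc i < k \<Longrightarrow> strict_prefix (v i) (v (Suc i))"
    and alt: "\<And>i. Suc i < k \<Longrightarrow>
      (u, v (Suc i)) \<in> language t1 F1 \<longleftrightarrow> (u, v i) \<notin> language t1 F1"
    using chain by (auto simp: persistent_chain_def k_def v_def)
  have step: "v (Suc i) = v i @ suffix_step v i" "suffix_step v i \<noteq> []" if "Suc i < k" for i
    using pref[OF that] by (auto simp: suffix_step_def strict_prefix_def prefix_def)
  have v_ne: "v i \<noteq> []" if "i < k" for i
    using pers[OF that] by (simp add: persistent_def duo_normalized_def normalized_def)
  have run_y: "run (progress_at F1 u) (z @ y i) = run (progress_at F1 u) (z @ v i)"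
    "run (leading F1) (u @ y i) = run (leading F1) u" if "i < k" for i z
    unfolding y_def by (rule run_pumped[OF that pers step(1) c(2)]; assumption)+
  have w_ne: "w i \<noteq> []" for i
    using rest_descent_nonempty[of v c i] v_ne[OF k] c(1) by (simp add: w_def rotated_def)
  have member: "(u', w i) \<in> language t1 F1 \<longleftrightarrow> (u, v i) \<in> language t1 F1"
    and loop: "run (leading F2) (u' @ w i) = run (leading F2) u'" if i: "i < k" for i
  proof -
    obtain h where h: "descent c v k = h @ word_power c (y i) @ descent c v i"
      "run (leading F1) (u @ h) = run (leading F1) u"
      using descent_decomp[OF i, where D="leading F1" and u=u and c=c and v=v] run_y(2)
      unfolding y_def by blast
    have y_ne: "y i \<noteq> []"
      using descent_rest[of c v i] rest_descent_nonempty[of v c i] v_ne[OF k] by (auto simp: y_def)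
    have D: "progress_at F1 (u @ h) = progress_at F1 u"
      using h(2) by (simp add: progress_at_def)
    have dv: "duo_normalized F1 u (v i)"
      using pers[OF i] by (simp add: persistent_def)
    have "run (leading F1) ((u @ h) @ y i) = run (leading F1) (u @ h)"
      using run_append_cong[OF h(2), of "y i"] run_y(2)[OF i] h(2) by simp
    moreover have "run (progress_at F1 u) (y i @ y i) = run (progress_at F1 u) (y i)"
    proof -
      have "run (progress_at F1 u) (y i @ y i) = run (progress_at F1 u) (v i @ v i)"
        using run_y(1)[OF i, of "y i"] run_append_cong[OF run_y(1)[OF i, of "[]"], of "v i"] by simp
      with dv run_y(1)[OF i, of "[]"] show ?thesis by (simp add: duo_normalized_def)
    qed
    ultimately have dy: "duo_normalized F1 (u @ h) (y i)"
      using y_ne D by (simp add: duo_normalized_def normalized_def)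
    \<comment> \<open>Rotation turns the part from \<open>descent c v i\<close> on into the
      omega-power of \<open>y i\<close>, which absorbs the preceding power. What remains,
      \<open>u @ h\<close>, reaches the same leading state as \<open>u\<close>.\<close>
    have "u' \<frown> (w i)\<^sup>\<omega> = (u @ h) \<frown> (word_power c (y i) \<frown> (descent c v i \<frown> (w i)\<^sup>\<omega>))"
      by (simp add: u'_def h(1))
    also have "\<dots> = (u @ h) \<frown> (y i)\<^sup>\<omega>"
      using descent_conc_rotated_iter[where v=v and i=i, OF c(1) v_ne[OF k]] word_power_conc_iter[OF y_ne]
      by (simp only: w_def y_def)
    finally have "(u', w i) \<in> language t1 F1 \<longleftrightarrow> y i \<in> dfa_language (progress_at F1 (u @ h))"
      by (rule language_iff_duo_normalized[OF assms(3) w_ne _ dy])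
    also have "\<dots> \<longleftrightarrow> v i \<in> dfa_language (progress_at F1 u)"
      using run_y(1)[OF i, of "[]"] D by (simp add: dfa_language_def)
    also have "\<dots> \<longleftrightarrow> (u, v i) \<in> language t1 F1"
      by (rule language_iff_duo_normalized[OF assms(3) v_ne[OF i] refl dv, symmetric])
    finally show "(u', w i) \<in> language t1 F1 \<longleftrightarrow> (u, v i) \<in> language t1 F1" .
    \<comment> \<open>Reading \<open>w i\<close> after \<open>u'\<close> amounts to doubling the
      block \<open>word_power c (y i)\<close> before \<open>descent c v i\<close>. The leading
      automaton of \<open>F2\<close> cannot see this, as the block acts idempotently.\<close>
    have "u' @ w i = ((u @ h) @ word_power c (y i) @ word_power c (y i)) @ descent c v i"
      using descent_rotated[of c v i] by (simp add: u'_def h(1) w_def y_def)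
    moreover have "u' = ((u @ h) @ word_power c (y i)) @ descent c v i"
      by (simp add: u'_def h(1))
    moreover have "run (leading F2) ((u @ h) @ word_power c (y i) @ word_power c (y i))
        = run (leading F2) ((u @ h) @ word_power c (y i))"
      using c(3) unfolding stabilizing_def by blast
    ultimately show "run (leading F2) (u' @ w i) = run (leading F2) u'"
      using run_append_cong by metis
  qed
  \<comment> \<open>As \<open>w i\<close> is itself a \<open>c\<close>-th power, it acts
    idempotently after every \<open>z\<close>; this yields both duo-normalization and persistence
    with exponent 2.\<close>
  have idem: "run (progress_at F2 u') (z @ w i @ w i) = run (progress_at F2 u') (z @ w i)" for z i
    using c(4) by (simp add: stabilizing_def w_def rotated_def)
  have "persistent F2 u' (w i)" if "i < k" for i
    unfolding persistent_def duo_normalized_def normalized_def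
  proof (intro conjI allI)
    show "run (progress_at F2 u') (w i @ w i) = run (progress_at F2 u') (w i)"
      using idem[of "[]" i] by simp
    show "\<exists>j\<ge>2. run (progress_at F2 u') (z @ w i) = run (progress_at F2 u') (z @ word_power j (w i))" for z
      using idem[of z i] by (intro exI[of _ 2]) (simp add: numeral_2_eq_2)
  qed (use w_ne loop that in auto)
  moreover have "strict_prefix (w i) (w (Suc i))" if "Suc i < k" for i
    unfolding w_def by (rule strict_prefix_rotated[OF c(1) step(2)[OF that]])
  ultimately have "persistent_chain t2 F2 u' (map w [0..<k])"
    using k alt member by (simp add: persistent_chain_def flip: lang)
  moreover have "(u', hd (map w [0..<k])) \<in> language t2 F2 \<longleftrightarrow> (u, hd vs) \<in> language t1 F1"
    using member[OF k] k by (simp add: hd_map hd_conv_nth v_def k_def flip: lang)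
  ultimately show thesis
    by (rule that[rotated]) (simp add: k_def)
qed

text \<open>Comparing the sets of chain lengths by inclusion makes the suprema monotone, so no
  maximum has to exist.\<close>

lemma diameters_le:
  fixes F1 :: "('q1, 's1, 'a::finite) fdfa" and F2 :: "('q2, 's2, 'a) fdfa"
  assumes "fdfa F1" and "fdfa F2" and "saturated t1 F1" and "language t1 F1 = language t2 F2"
  shows "positive_diameter t1 F1 \<le> positive_diameter t2 F2"
    and "negative_diameter t1 F1 \<le> negative_diameter t2 F2"
proof -
  have "{enat (length vs) | u vs. positive_chain t1 F1 u vs}
      \<subseteq> {enat (length vs) | u vs. positive_chain t2 F2 u vs}"
  proof safe
    fix u vs
    assume "positive_chain t1 F1 u vs"
    then show "\<exists>u' ws. enat (length vs) = enat (length ws) \<and> positive_chain t2 F2 u' ws"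
      unfolding positive_chain_def using persistent_chain_transfer[OF assms, of u vs] by metis
  qed
  then show "positive_diameter t1 F1 \<le> positive_diameter t2 F2"
    unfolding positive_diameter_def by (rule Sup_subset_mono)
  have "{enat (length vs) | u vs. negative_chain t1 F1 u vs}
      \<subseteq> {enat (length vs) | u vs. negative_chain t2 F2 u vs}"
  proof safe
    fix u vs
    assume "negative_chain t1 F1 u vs"
    then show "\<exists>u' ws. enat (length vs) = enat (length ws) \<and> negative_chain t2 F2 u' ws"
      unfolding negative_chain_def using persistent_chain_transfer[OF assms, of u vs] by metis
  qed
  then show "negative_diameter t1 F1 \<le> negative_diameter t2 F2"
    unfolding negative_diameter_def by (rule Sup_subset_mono)
qed

theorem corollary16:
  fixes F1 :: "('q1, 's1, 'a::finite) fdfa"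
    and F2 :: "('q2, 's2, 'a) fdfa"
    and t1 t2 :: acceptance
  assumes "fdfa F1" and "fdfa F2"
    and "saturated t1 F1" and "saturated t2 F2"
    and "language t1 F1 = language t2 F2"
  shows "positive_diameter t1 F1 = positive_diameter t2 F2 \<and>
         negative_diameter t1 F1 = negative_diameter t2 F2"
  using diameters_le[OF assms(1,2,3,5)] diameters_le[OF assms(2,1,4) assms(5)[symmetric]]
  by (simp add: antisym)

end
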